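(* Let $\mu$ be a probability measure on $\mathbb N^d$ with downward closed support, and for $\mathbf n\in\mathrm{supp}(\mu)$ let $\mathbf K_{\mathbf n}$ be its local curvature matrix $$\mathbf K_{\mathbf n}=\Big(1-\frac{a(\mathbf n)\,a(\mathbf n+\mathbf e_i+\mathbf e_j)}{a(\mathbf n+\mathbf e_i)\,a(\mathbf n+\mathbf e_j)}\Big)_{i,j\in\mathcal I_{\mathbf n}}+\mathrm{diag}\Big(\frac{a(\mathbf n)}{a(\mathbf n+\mathbf e_i)}\Big)_{i\in\mathcal I_{\mathbf n}} .$$ Suppose that $\mathbf K_{\mathbf n}$ is positive definite for every $\mathbf n\in\mathrm{supp}(\mu)$. Then for every finitely supported function $f:\mathrm{supp}(\mu)\to\mathbb R$, $$\mathrm{Var}_\mu[f]\;\le\;\mathbf E_{\mathbf n\sim\mu}\Big[\big(\nabla^+f(\mathbf n)\big)_{\mathcal I_{\mathbf n}}^{\top}\,\mathbf K_{\mathbf n}^{-1}\,\big(\nabla^+f(\mathbf n)\big)_{\mathcal I_{\mathbf n}}\Big].$$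
   Context: $\mathbb N=\{0,1,2,\dots\}$, $[d]=\{1,\dots,d\}$, $\mathbf e_i$ is the $i$-th standard basis vector, $\mathbf n!=\prod_{i=1}^d n_i!$. A set $S\subseteq\mathbb N^d$ is downward closed if $\mathbf n\in S$ and $\mathbf 0\le\mathbf m\le\mathbf n$ (coordinatewise) imply $\mathbf m\in S$. $\mathrm{supp}(\mu)=\{\mathbf n:\mu(\mathbf n)>0\}$, $a(\mathbf n)=\mathbf n!\,\mu(\mathbf n)$ (so $a=0$ off the support), and $\mathcal I_{\mathbf n}=\{i\in[d]:\mathbf n+\mathbf e_i\in\mathrm{supp}(\mu)\}$ is the set of active birth coordinates. $(\nabla^+f(\mathbf n))_{\mathcal I_{\mathbf n}}$ is the vector indexed by $i\in\mathcal I_{\mathbf n}$ with entries $\nabla_i^+f(\mathbf n)=f(\mathbf n+\mathbf e_i)-f(\mathbf n)$; when $\mathcal I_{\mathbf n}=\varnothing$ the quadratic form is $0$ and positive definiteness is vacuous. *)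

theory Defs
  imports "HOL-Probability.Probability"
begin

text \<open>
  Points of \<open>\<nat>\<^sup>d\<close> are vectors of type \<^typ>\<open>nat ^ 'd\<close> with coordinate set \<^typ>\<open>'d::finite\<close>;
  the order \<open>\<le>\<close> on this type is the coordinatewise one and \<open>axis i 1\<close> is the \<open>i\<close>-th
  standard basis vector.
\<close>

definition downward_closed :: "(nat ^ 'd) set \<Rightarrow> bool" where
  "downward_closed S \<longleftrightarrow> (\<forall>n\<in>S. \<forall>m. m \<le> n \<longrightarrow> m \<in> S)"

definition vec_fact :: "nat ^ 'd::finite \<Rightarrow> real" where
  "vec_fact n = (\<Prod>i\<in>UNIV. fact (n $ i))"

definition weight :: "(nat ^ 'd::finite) pmf \<Rightarrow> nat ^ 'd \<Rightarrow> real" where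
  "weight \<mu> n = vec_fact n * pmf \<mu> n"

definition active :: "(nat ^ 'd::finite) pmf \<Rightarrow> nat ^ 'd \<Rightarrow> 'd set" where
  "active \<mu> n = {i. n + axis i 1 \<in> set_pmf \<mu>}"

definition forward_diff :: "(nat ^ 'd::finite \<Rightarrow> real) \<Rightarrow> nat ^ 'd \<Rightarrow> 'd \<Rightarrow> real" where
  "forward_diff f n i = f (n + axis i 1) - f n"

text \<open>
  The index set \<open>active \<mu> n\<close> varies with \<open>n\<close>, so a matrix indexed by \<open>I \<times> I\<close> is represented by
  a function \<^typ>\<open>'d \<Rightarrow> 'd \<Rightarrow> real\<close> of which only the entries with both indices in \<open>I\<close> are
  meaningful; likewise for vectors. None of the following notions depends on the other entries,
  except for the irrelevant entries of \<open>inverse_on I K\<close> itself.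
\<close>

definition quad_form_on :: "'d set \<Rightarrow> ('d \<Rightarrow> 'd \<Rightarrow> real) \<Rightarrow> ('d \<Rightarrow> real) \<Rightarrow> real" where
  "quad_form_on I K x = (\<Sum>i\<in>I. \<Sum>j\<in>I. x i * K i j * x j)"

definition pos_def_on :: "'d set \<Rightarrow> ('d \<Rightarrow> 'd \<Rightarrow> real) \<Rightarrow> bool" where
  "pos_def_on I K \<longleftrightarrow>
     (\<forall>i\<in>I. \<forall>j\<in>I. K i j = K j i) \<and>
     (\<forall>x. (\<exists>i\<in>I. x i \<noteq> 0) \<longrightarrow> 0 < quad_form_on I K x)"

text \<open>As for \<^const>\<open>matrix_inv\<close>, the value is unspecified if there is no two-sided inverse.\<close>

definition inverse_on :: "'d set \<Rightarrow> ('d \<Rightarrow> 'd \<Rightarrow> real) \<Rightarrow> 'd \<Rightarrow> 'd \<Rightarrow> real" where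
  "inverse_on I K = (SOME L. \<forall>i\<in>I. \<forall>j\<in>I.
     (\<Sum>k\<in>I. K i k * L k j) = (if i = j then 1 else 0) \<and>
     (\<Sum>k\<in>I. L i k * K k j) = (if i = j then 1 else 0))"

definition curvature_matrix ::
  "(nat ^ 'd::finite) pmf \<Rightarrow> nat ^ 'd \<Rightarrow> 'd \<Rightarrow> 'd \<Rightarrow> real" where
  "curvature_matrix \<mu> n i j =
     (1 - weight \<mu> n * weight \<mu> (n + axis i 1 + axis j 1)
            / (weight \<mu> (n + axis i 1) * weight \<mu> (n + axis j 1)))
     + (if i = j then weight \<mu> n / weight \<mu> (n + axis i 1) else 0)"

end

theory Submission imports Defs begin

text \<open>
  The proof is a discrete Bochner--Hoermander argument. Let \<open>L\<close> be the generator of the birth-death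
  chain reversible for \<open>\<mu>\<close>. If \<open>\<mu>\<close> has finite support and \<open>f\<close> has mean zero, solve \<open>- L g = f\<close> and put
  \<open>u\<^sub>i n = a (n + e\<^sub>i) / a n * \<nabla>\<^sub>i g n\<close>. Summation by parts gives \<open>E f\<^sup>2 = E \<langle>\<nabla>f, u\<rangle>\<close>, and commuting \<open>\<nabla>\<close>
  with \<open>L\<close> gives \<open>E (L g)\<^sup>2 \<ge> E \<langle>u, K u\<rangle>\<close>. Hence
  \<open>E f\<^sup>2 \<le> E (2 \<langle>\<nabla>f, u\<rangle> - \<langle>u, K u\<rangle>) \<le> E \<langle>\<nabla>f, K\<inverse> \<nabla>f\<rangle>\<close>.
  Infinite supports are exhausted by boxes: restricting \<open>\<mu>\<close> to a box only increases the curvature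
  matrices.
\<close>

declare One_nat_def [simp del]

section \<open>Linear algebra on finite index sets\<close>

text \<open>Block elimination, adding one index \<open>p\<close> at a time: solve on
  \<open>J\<close> for \<open>v\<close> and for column \<open>p\<close>, then fit the value
  \<open>t\<close> at \<open>p\<close>. The pivot \<open>s\<close> is a Schur complement, positive
  because it is the value of the form at the vector with entry 1 at \<open>p\<close> and
  \<open>- w\<close> on \<open>J\<close>.\<close>

lemma pos_quadratic_solvable:
  fixes K :: "'a \<Rightarrow> 'a \<Rightarrow> real"
  assumes "finite I"
    and "\<And>x. \<exists>i\<in>I. x i \<noteq> 0 \<Longrightarrow> 0 < (\<Sum>i\<in>I. \<Sum>j\<in>I. x i * K i j * x j)"
  shows "\<exists>x. \<forall>i\<in>I. (\<Sum>j\<in>I. K i j * x j) = v i"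
  using assms
proof (induction I arbitrary: v rule: finite_induct)
  case empty
  then show ?case by simp
next
  case (insert p J)
  have neq: "j \<noteq> p" if "j \<in> J" for j
    using insert.hyps that by auto
  have pos: "0 < (\<Sum>i\<in>J. \<Sum>j\<in>J. x i * K i j * x j)" if "\<exists>i\<in>J. x i \<noteq> 0" for x
  proof -
    let ?y = "x(p := 0)"
    have "0 < (\<Sum>i\<in>insert p J. \<Sum>j\<in>insert p J. ?y i * K i j * ?y j)"
      using that neq by (intro insert.prems) auto
    also have "\<dots> = (\<Sum>i\<in>J. \<Sum>j\<in>J. x i * K i j * x j)"
      using insert.hyps neq by simp
    finally show ?thesis .
  qed
  obtain y where y: "\<And>i. i \<in> J \<Longrightarrow> (\<Sum>j\<in>J. K i j * y j) = v i"
    using insert.IH[OF pos, of v] by blast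
  obtain w where w: "\<And>i. i \<in> J \<Longrightarrow> (\<Sum>j\<in>J. K i j * w j) = K i p"
    using insert.IH[OF pos, of "\<lambda>i. K i p"] by blast
  define s where "s = K p p - (\<Sum>j\<in>J. K p j * w j)"
  have "0 < s"
  proof -
    let ?x = "\<lambda>i. if i = p then 1 else - w i"
    have "0 < (\<Sum>i\<in>insert p J. \<Sum>j\<in>insert p J. ?x i * K i j * ?x j)"
      by (intro insert.prems) auto
    also have "\<dots> = (\<Sum>i\<in>insert p J. ?x i * (\<Sum>j\<in>insert p J. K i j * ?x j))"
      by (simp add: sum_distrib_left mult.assoc)
    also have "\<dots> = s + (\<Sum>i\<in>J. ?x i * (K i p - (\<Sum>j\<in>J. K i j * w j)))"
      using insert.hyps neq by (simp add: s_def sum_negf)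
    also have "(\<Sum>i\<in>J. ?x i * (K i p - (\<Sum>j\<in>J. K i j * w j))) = 0"
      by (intro sum.neutral) (simp add: w)
    finally show ?thesis by simp
  qed
  define t where "t = (v p - (\<Sum>j\<in>J. K p j * y j)) / s"
  define x where "x = (\<lambda>i. if i = p then t else y i - t * w i)"
  have x: "(\<Sum>j\<in>insert p J. K i j * x j)
      = t * (K i p - (\<Sum>j\<in>J. K i j * w j)) + (\<Sum>j\<in>J. K i j * y j)" for i
  proof -
    have "(\<Sum>j\<in>J. K i j * x j) = (\<Sum>j\<in>J. K i j * y j - t * (K i j * w j))"
      by (intro sum.cong) (auto simp: x_def neq algebra_simps)
    then show ?thesis
      using insert.hyps by (simp add: x_def sum_subtractf sum_distrib_left algebra_simps)
  qed
  have "(\<Sum>j\<in>insert p J. K i j * x j) = v i" if "i \<in> insert p J" for i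
  proof (cases "i = p")
    case True
    have "t * s = v p - (\<Sum>j\<in>J. K p j * y j)"
      using \<open>0 < s\<close> by (simp add: t_def)
    then show ?thesis
      unfolding x True using s_def by simp
  next
    case False
    then show ?thesis
      using that unfolding x by (simp add: y w)
  qed
  then show ?case by blast
qed

text \<open>\<open>inverse_on\<close> is a choice, so a two-sided inverse must be exhibited. Solving
  for each unit vector gives a right inverse; symmetry of \<open>K\<close> makes it symmetric on
  \<open>I\<close>, hence also a left inverse.\<close>

lemma inverse_on_right:
  fixes K :: "'d \<Rightarrow> 'd \<Rightarrow> real"
  assumes "finite I" "pos_def_on I K" "i \<in> I" "j \<in> I"
  shows "(\<Sum>k\<in>I. K i k * inverse_on I K k j) = (if i = j then 1 else 0)"
proof -
  have sym: "K i j = K j i" if "i \<in> I" "j \<in> I" for i j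
    using assms(2) that by (auto simp: pos_def_on_def)
  have "\<exists>x. \<forall>i\<in>I. (\<Sum>k\<in>I. K i k * x k) = (if i = j then 1 else 0)" for j
    using assms by (intro pos_quadratic_solvable) (auto simp: pos_def_on_def quad_form_on_def)
  then obtain R where R: "\<And>i j. i \<in> I \<Longrightarrow> (\<Sum>k\<in>I. K i k * R j k) = (if i = j then 1 else 0)"
    by metis
  have Rsym: "R i j = R j i" if "i \<in> I" "j \<in> I" for i j
  proof -
    have "R i j = (\<Sum>k\<in>I. R i k * (\<Sum>l\<in>I. K k l * R j l))"
      using that assms(1) by (simp add: R if_distrib cong: if_cong)
    also have "\<dots> = (\<Sum>k\<in>I. \<Sum>l\<in>I. R j l * (K l k * R i k))"
      by (simp add: sum_distrib_left sym ac_simps)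
    also have "\<dots> = (\<Sum>l\<in>I. R j l * (\<Sum>k\<in>I. K l k * R i k))"
      by (subst sum.swap) (simp add: sum_distrib_left)
    also have "\<dots> = R j i"
      using that assms(1) by (simp add: R if_distrib cong: if_cong)
    finally show ?thesis .
  qed
  have left: "(\<Sum>k\<in>I. R k i * K k j) = (if i = j then 1 else 0)" if "i \<in> I" "j \<in> I" for i j
  proof -
    have "(\<Sum>k\<in>I. R k i * K k j) = (\<Sum>k\<in>I. K j k * R i k)"
      using that by (intro sum.cong) (auto simp: Rsym sym)
    then show ?thesis using R[of j i] that by auto
  qed
  have "\<forall>i\<in>I. \<forall>j\<in>I.
     (\<Sum>k\<in>I. K i k * inverse_on I K k j) = (if i = j then 1 else 0) \<and>
     (\<Sum>k\<in>I. inverse_on I K i k * K k j) = (if i = j then 1 else 0)"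
    unfolding inverse_on_def
  proof (rule someI[where x = "\<lambda>k j. R j k"], intro ballI conjI)
    fix i j assume "i \<in> I" "j \<in> I"
    then show "(\<Sum>k\<in>I. K i k * R j k) = (if i = j then 1 else 0)"
      "(\<Sum>k\<in>I. R k i * K k j) = (if i = j then 1 else 0)"
      using R left by auto
  qed
  then show ?thesis
    using assms by blast
qed

text \<open>Completing the square: with \<open>x\<close> the inverse applied to \<open>v\<close>,
  the gap between the two sides is the form of \<open>K\<close> at \<open>u - x\<close>.\<close>

lemma quad_form_on_inverse_ge:
  fixes K :: "'d \<Rightarrow> 'd \<Rightarrow> real"
  assumes "finite I" "pos_def_on I K"
  shows "2 * (\<Sum>i\<in>I. u i * v i) - quad_form_on I K u \<le> quad_form_on I (inverse_on I K) v"
proof -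
  have sym: "K i j = K j i" if "i \<in> I" "j \<in> I" for i j
    using assms(2) that by (auto simp: pos_def_on_def)
  define x where "x = (\<lambda>i. \<Sum>j\<in>I. inverse_on I K i j * v j)"
  have Kx: "(\<Sum>k\<in>I. K i k * x k) = v i" if "i \<in> I" for i
  proof -
    have "(\<Sum>k\<in>I. K i k * x k) = (\<Sum>j\<in>I. (\<Sum>k\<in>I. K i k * inverse_on I K k j) * v j)"
      unfolding x_def sum_distrib_left sum_distrib_right
      by (subst sum.swap) (simp add: ac_simps)
    also have "\<dots> = v i"
      using that assms by (simp add: inverse_on_right if_distrib[of "\<lambda>c. c * _"] cong: if_cong)
    finally show ?thesis .
  qed
  have row: "(\<Sum>i\<in>I. \<Sum>j\<in>I. y i * K i j * x j) = (\<Sum>i\<in>I. y i * v i)" for y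
    by (simp add: Kx mult.assoc flip: sum_distrib_left)
  have "quad_form_on I K (\<lambda>i. u i - x i) = (\<Sum>i\<in>I. \<Sum>j\<in>I.
      u i * K i j * u j - u i * K i j * x j - x i * K i j * u j + x i * K i j * x j)"
    by (simp add: quad_form_on_def algebra_simps)
  also have "\<dots> = quad_form_on I K u - (\<Sum>i\<in>I. u i * v i)
      - (\<Sum>i\<in>I. \<Sum>j\<in>I. x i * K i j * u j) + (\<Sum>i\<in>I. x i * v i)"
    by (simp add: sum.distrib sum_subtractf row quad_form_on_def)
  also have "(\<Sum>i\<in>I. \<Sum>j\<in>I. x i * K i j * u j) = (\<Sum>j\<in>I. \<Sum>i\<in>I. u j * K j i * x i)"
    by (subst sum.swap) (simp add: sym ac_simps)
  also have "\<dots> = (\<Sum>i\<in>I. u i * v i)"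
    by (rule row)
  also have "(\<Sum>i\<in>I. x i * v i) = quad_form_on I (inverse_on I K) v"
    unfolding quad_form_on_def x_def sum_distrib_right sum_distrib_left
    by (simp add: ac_simps)
  finally have "quad_form_on I K (\<lambda>i. u i - x i)
      = quad_form_on I K u - 2 * (\<Sum>i\<in>I. u i * v i) + quad_form_on I (inverse_on I K) v"
    by simp
  moreover have "0 \<le> quad_form_on I K (\<lambda>i. u i - x i)"
  proof (cases "\<exists>i\<in>I. u i - x i \<noteq> 0")
    case True
    then show ?thesis
      using assms(2) unfolding pos_def_on_def
      by (metis (mono_tags, lifting) less_imp_le)
  next
    case False
    then show ?thesis
      by (simp add: quad_form_on_def)
  qed
  ultimately show ?thesis by simp
qed

section \<open>Factorials and unit steps on the lattice\<close>

lemma vec_fact_pos: "0 < vec_fact n"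
  by (simp add: vec_fact_def prod_pos)

lemma vec_fact_add_axis: "vec_fact (n + axis i 1) = (real (n $ i) + 1) * vec_fact n"
proof -
  have "(\<Prod>k\<in>UNIV - {i}. fact ((n + axis i 1) $ k)) = (\<Prod>k\<in>UNIV - {i}. fact (n $ k) :: real)"
    by (intro prod.cong) (auto simp: axis_def)
  then show ?thesis
    by (simp add: vec_fact_def prod.remove[of UNIV i] axis_def fact_Suc flip: Suc_eq_plus1)
qed

lemma diff_axis_add_axis:
  fixes n :: "nat ^ 'd"
  shows "0 < n $ i \<Longrightarrow> n - axis i 1 + axis i 1 = n"
  by (auto simp: vec_eq_iff axis_def)

lemma add_axis_diff_axis:
  fixes n :: "nat ^ 'd"
  shows "n + axis i 1 - axis i 1 = n"
  by (auto simp: vec_eq_iff axis_def)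

lemma add_axis_diff_axis_swap:
  fixes n :: "nat ^ 'd"
  shows "0 < n $ j \<Longrightarrow> n + axis i 1 - axis j 1 = n - axis j 1 + axis i 1"
  by (auto simp: vec_eq_iff axis_def)

lemma downward_closed_add_axisD:
  fixes S :: "(nat ^ 'd) set"
  shows "downward_closed S \<Longrightarrow> n + axis i 1 \<in> S \<Longrightarrow> n \<in> S"
  unfolding downward_closed_def less_eq_vec_def
  by (metis le_add1 vector_add_component)

lemma forward_diff_commute:
  "forward_diff (\<lambda>k. forward_diff g k i) n j = forward_diff (\<lambda>k. forward_diff g k j) n i"
  by (simp add: forward_diff_def ac_simps)

text \<open>Taken for an arbitrary weight, so that it can be evaluated both at
  \<open>weight \<mu>\<close> and at its truncation to a box.\<close>

definition curvature :: "(nat ^ 'd::finite \<Rightarrow> real) \<Rightarrow> nat ^ 'd \<Rightarrow> 'd \<Rightarrow> 'd \<Rightarrow> real" where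
  "curvature a n i j =
     (1 - a n * a (n + axis i 1 + axis j 1) / (a (n + axis i 1) * a (n + axis j 1)))
     + (if i = j then a n / a (n + axis i 1) else 0)"

lemma curvature_matrix_eq: "curvature_matrix \<mu> = curvature (weight \<mu>)"
  by (simp add: fun_eq_iff curvature_matrix_def curvature_def)

section \<open>The reversible birth-death chain on a finite support\<close>

text \<open>The weight is not normalised, because it will come from restricting a measure to a box.
  Vanishing off \<open>S\<close> allows sums over all coordinates in place of active sets.\<close>

locale finite_weight =
  fixes a :: "nat ^ 'd::finite \<Rightarrow> real" and S :: "(nat ^ 'd) set"
  assumes finite_S: "finite S" and S_dc: "downward_closed S" and zero_in_S: "0 \<in> S"
    and a_pos: "\<And>n. n \<in> S \<Longrightarrow> 0 < a n" and a_zero: "\<And>n. n \<notin> S \<Longrightarrow> a n = 0"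
begin

lemma a_nonneg: "0 \<le> a n"
  using a_pos[of n] a_zero[of n] by (cases "n \<in> S") auto

definition mass :: "nat ^ 'd \<Rightarrow> real" where
  "mass n = a n / vec_fact n"

text \<open>For \<open>n\<close> in \<open>S\<close> the coefficient is the flow from
  \<open>n\<close> to \<open>n + axis i 1\<close>, that is, \<open>mass n\<close> times the birth
  rate \<open>a (n + axis i 1) / a n\<close>.\<close>

definition dirichlet :: "(nat ^ 'd \<Rightarrow> real) \<Rightarrow> (nat ^ 'd \<Rightarrow> real) \<Rightarrow> real" where
  "dirichlet g h = (\<Sum>n\<in>S. \<Sum>i\<in>UNIV.
     a (n + axis i 1) / vec_fact n * forward_diff g n i * forward_diff h n i)"

text \<open>Minus the generator of the birth-death chain reversible for \<^const>\<open>mass\<close>, with death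
  rates \<open>n $ j\<close> and birth rates \<open>a (n + axis j 1) / a n\<close>.\<close>

definition neg_gen :: "(nat ^ 'd \<Rightarrow> real) \<Rightarrow> nat ^ 'd \<Rightarrow> real" where
  "neg_gen g n = (\<Sum>j\<in>UNIV. real (n $ j) * forward_diff g (n - axis j 1) j
     - a (n + axis j 1) / a n * forward_diff g n j)"

lemma mass_pos: "n \<in> S \<Longrightarrow> 0 < mass n"
  by (simp add: mass_def a_pos vec_fact_pos)

lemma S_add_axisD: "n + axis i 1 \<in> S \<Longrightarrow> n \<in> S"
  using S_dc by (rule downward_closed_add_axisD)

text \<open>Reindexing by \<open>n - axis j 1\<close>: the factor \<open>n $ j\<close> turns
  \<open>vec_fact n\<close> into the factorial of the lowered point, and it kills the points with
  \<open>n $ j = 0\<close>, where subtraction truncates. This is the detailed balance behind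
  \<open>sum_neg_gen\<close>.\<close>

lemma sum_shift:
  assumes "\<And>n. n \<notin> S \<Longrightarrow> q n = 0"
  shows "(\<Sum>n\<in>S. real (n $ j) * q n / vec_fact n) = (\<Sum>n\<in>S. q (n + axis j 1) / vec_fact n)"
proof -
  have "(\<Sum>n\<in>S. real (n $ j) * q n / vec_fact n)
      = (\<Sum>n\<in>{n\<in>S. 0 < n $ j}. real (n $ j) * q n / vec_fact n)"
    using finite_S by (intro sum.mono_neutral_right) auto
  also have "\<dots> = (\<Sum>n\<in>{n. n + axis j 1 \<in> S}. q (n + axis j 1) / vec_fact n)"
  proof (intro sum.reindex_bij_witness[where i = "\<lambda>n. n + axis j 1" and j = "\<lambda>n. n - axis j 1"])
    fix n assume "n \<in> {n \<in> S. 0 < n $ j}"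
    then have n: "n \<in> S" "0 < n $ j" "n - axis j 1 + axis j 1 = n"
      by (auto simp: diff_axis_add_axis)
    show "n - axis j 1 + axis j 1 = n" "n - axis j 1 \<in> {n. n + axis j 1 \<in> S}"
      using n by auto
    have "vec_fact n = real (n $ j) * vec_fact (n - axis j 1)"
      using vec_fact_add_axis[of "n - axis j 1" j] n by (simp add: axis_def)
    then show "q (n - axis j 1 + axis j 1) / vec_fact (n - axis j 1)
        = real (n $ j) * q n / vec_fact n"
      using n by simp
  qed (auto simp: add_axis_diff_axis)
  also have "\<dots> = (\<Sum>n\<in>S. q (n + axis j 1) / vec_fact n)"
    using finite_S S_add_axisD assms by (intro sum.mono_neutral_left) auto
  finally show ?thesis .
qed

text \<open>Summation by parts: \<open>sum_shift\<close> turns the death terms into terms in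
  \<open>h (n + axis j 1)\<close>, which combine with the birth terms into differences of
  \<open>h\<close>.\<close>

lemma sum_neg_gen: "(\<Sum>n\<in>S. mass n * neg_gen g n * h n) = dirichlet g h"
proof -
  let ?D = "forward_diff g"
  have "(\<Sum>n\<in>S. mass n * neg_gen g n * h n) = (\<Sum>n\<in>S. \<Sum>j\<in>UNIV.
      real (n $ j) * (a n * ?D (n - axis j 1) j * h n) / vec_fact n
      - a (n + axis j 1) * ?D n j * h n / vec_fact n)"
    unfolding neg_gen_def sum_distrib_left sum_distrib_right
  proof (intro sum.cong refl)
    fix n j assume "n \<in> S"
    then show "mass n * (real (n $ j) * ?D (n - axis j 1) j - a (n + axis j 1) / a n * ?D n j) * h n
        = real (n $ j) * (a n * ?D (n - axis j 1) j * h n) / vec_fact n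
          - a (n + axis j 1) * ?D n j * h n / vec_fact n"
      using a_pos[of n] vec_fact_pos[of n] by (simp add: mass_def field_simps)
  qed
  also have "\<dots> = (\<Sum>j\<in>UNIV.
      (\<Sum>n\<in>S. real (n $ j) * (a n * ?D (n - axis j 1) j * h n) / vec_fact n)
      - (\<Sum>n\<in>S. a (n + axis j 1) * ?D n j * h n / vec_fact n))"
    by (subst sum.swap) (simp add: sum_subtractf)
  also have "\<dots> = (\<Sum>j\<in>UNIV. \<Sum>n\<in>S.
      a (n + axis j 1) / vec_fact n * ?D n j * forward_diff h n j)"
  proof (intro sum.cong refl)
    fix j
    show "(\<Sum>n\<in>S. real (n $ j) * (a n * ?D (n - axis j 1) j * h n) / vec_fact n)
        - (\<Sum>n\<in>S. a (n + axis j 1) * ?D n j * h n / vec_fact n)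
        = (\<Sum>n\<in>S. a (n + axis j 1) / vec_fact n * ?D n j * forward_diff h n j)"
      by (subst sum_shift, simp add: a_zero)
        (simp add: add_axis_diff_axis forward_diff_def[of h] algebra_simps diff_divide_distrib
          flip: sum_subtractf)
  qed
  also have "\<dots> = dirichlet g h"
    unfolding dirichlet_def by (rule sum.swap)
  finally show ?thesis .
qed

lemma dirichlet_nonneg: "0 \<le> dirichlet g g"
  unfolding dirichlet_def
  by (intro sum_nonneg) (simp add: a_nonneg vec_fact_pos less_imp_le mult.assoc)

text \<open>A zero sum of nonnegative terms makes \<open>g\<close> agree across every edge inside
  \<open>S\<close>, and downward closure lets each point descend to 0 without leaving
  \<open>S\<close>.\<close>

lemma dirichlet_eq_0_imp_const:
  assumes "dirichlet g g = 0" "n \<in> S"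
  shows "g n = g 0"
proof -
  have zero: "\<forall>n\<in>S. \<forall>i. a (n + axis i 1) / vec_fact n * forward_diff g n i * forward_diff g n i = 0"
    using assms(1) finite_S unfolding dirichlet_def
    by (subst (asm) sum_nonneg_eq_0_iff)
      (auto intro!: sum_nonneg simp: a_nonneg vec_fact_pos less_imp_le mult.assoc
        sum_nonneg_eq_0_iff)
  then have step: "g (n + axis i 1) = g n" if "n + axis i 1 \<in> S" for n i
  proof -
    have "a (n + axis i 1) / vec_fact n * forward_diff g n i * forward_diff g n i = 0"
      using zero S_add_axisD[OF that] by blast
    then show ?thesis
      using a_pos[OF that] vec_fact_pos[of n] by (simp add: forward_diff_def)
  qed
  show ?thesis
    using assms(2)
  proof (induction "\<Sum>i\<in>UNIV. n $ i" arbitrary: n rule: less_induct)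
    case less
    show ?case
    proof (cases "n = 0")
      case False
      then obtain i where "0 < n $ i"
        by (auto simp: vec_eq_iff)
      define k where "k = n - axis i 1"
      have n: "n = k + axis i 1"
        using \<open>0 < n $ i\<close> by (simp add: k_def diff_axis_add_axis)
      have "(\<Sum>j\<in>UNIV. k $ j) < (\<Sum>j\<in>UNIV. n $ j)"
        by (intro sum_strict_mono_ex1) (auto simp: n axis_def)
      then have "g k = g 0"
        using less S_add_axisD[of k i] n by auto
      then show ?thesis
        using step[of k i] less.prems n by simp
    qed simp
  qed
qed

lemma neg_gen_sum: "neg_gen (\<lambda>n. \<Sum>k\<in>S. x k * g k n) n = (\<Sum>k\<in>S. x k * neg_gen (g k) n)"
proof -
  have "forward_diff (\<lambda>n. \<Sum>k\<in>S. x k * g k n) n j = (\<Sum>k\<in>S. x k * forward_diff (g k) n j)" for n j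
    by (simp add: forward_diff_def right_diff_distrib sum_subtractf)
  then have "neg_gen (\<lambda>n. \<Sum>k\<in>S. x k * g k n) n = (\<Sum>j\<in>UNIV. \<Sum>k\<in>S.
      x k * (real (n $ j) * forward_diff (g k) (n - axis j 1) j
        - a (n + axis j 1) / a n * forward_diff (g k) n j))"
    by (simp add: neg_gen_def sum_distrib_left right_diff_distrib sum_subtractf ac_simps)
  also have "\<dots> = (\<Sum>k\<in>S. x k * neg_gen (g k) n)"
    unfolding neg_gen_def sum_distrib_left by (rule sum.swap)
  finally show ?thesis .
qed

text \<open>The rank-one perturbation \<open>mass n * mass k\<close> removes the constants from the kernel of the
  generator; it contributes nothing to the solution because \<open>f\<close> has mean zero.\<close>

lemma neg_gen_solvable:
  assumes "(\<Sum>n\<in>S. mass n * f n) = 0"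
  obtains g where "\<And>n. n \<in> S \<Longrightarrow> neg_gen g n = f n"
proof -
  \<comment> \<open>In the basis of unit masses \<open>e k\<close>, \<open>X x\<close> extends a
    vector on \<open>S\<close> by zero, and \<open>M\<close> is the matrix of the perturbed
    generator weighted by \<open>mass\<close>.\<close>
  define e where "e k n = (if n = k then 1 else 0 :: real)" for k n :: "nat ^ 'd"
  define M where "M n k = mass n * neg_gen (e k) n + mass n * mass k" for n k
  define X where "X x = (\<lambda>n. \<Sum>k\<in>S. x k * e k n)" for x
  have X: "X x n = x n" if "n \<in> S" for x n
    using that finite_S by (simp add: X_def e_def if_distrib cong: if_cong)
  have M: "(\<Sum>k\<in>S. M n k * x k) = mass n * neg_gen (X x) n + mass n * (\<Sum>k\<in>S. mass k * x k)" for n x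
    unfolding M_def X_def neg_gen_sum
    by (simp add: sum_distrib_left algebra_simps sum.distrib)
  have mass_total: "0 < (\<Sum>n\<in>S. mass n)"
    using finite_S zero_in_S mass_pos by (intro sum_pos) auto
  \<comment> \<open>The form is the Dirichlet form plus the square of the weighted sum of
    \<open>x\<close>. If it is not positive, both parts vanish, so \<open>x\<close> is constant on
    \<open>S\<close> with weighted sum zero, hence zero.\<close>
  have "0 < (\<Sum>n\<in>S. \<Sum>k\<in>S. x n * M n k * x k)" if "\<exists>n\<in>S. x n \<noteq> 0" for x
  proof (rule ccontr)
    have "(\<Sum>n\<in>S. \<Sum>k\<in>S. x n * M n k * x k) = (\<Sum>n\<in>S. x n * (\<Sum>k\<in>S. M n k * x k))"
      by (simp add: sum_distrib_left mult.assoc)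
    also have "\<dots> = (\<Sum>n\<in>S. mass n * neg_gen (X x) n * X x n)
        + (\<Sum>n\<in>S. mass n * x n) * (\<Sum>k\<in>S. mass k * x k)"
      unfolding M sum_distrib_right by (simp add: X algebra_simps sum.distrib)
    finally have eq: "(\<Sum>n\<in>S. \<Sum>k\<in>S. x n * M n k * x k)
        = dirichlet (X x) (X x) + (\<Sum>n\<in>S. mass n * x n)\<^sup>2"
      by (simp add: sum_neg_gen power2_eq_square)
    assume "\<not> ?thesis"
    then have 0: "dirichlet (X x) (X x) = 0" "(\<Sum>n\<in>S. mass n * x n) = 0"
      using dirichlet_nonneg[of "X x"] unfolding eq
      by (smt (verit) zero_le_power2 power_eq_0_iff)+
    have c: "x n = x 0" if "n \<in> S" for n
      using dirichlet_eq_0_imp_const[OF 0(1) that] X that zero_in_S by simp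
    have "(\<Sum>n\<in>S. mass n) * x 0 = 0"
      using 0(2) c unfolding sum_distrib_right by simp
    then have "x 0 = 0"
      using mass_total by simp
    then show False
      using that c by auto
  qed
  then obtain x where x: "\<And>n. n \<in> S \<Longrightarrow> (\<Sum>k\<in>S. M n k * x k) = mass n * f n"
    using pos_quadratic_solvable[OF finite_S, of M "\<lambda>n. mass n * f n"] by blast
  \<comment> \<open>Summing the equations over \<open>n\<close> pairs the generator with the
    constant 1, which gives zero; only the perturbation is left, so it vanishes.\<close>
  have "0 = (\<Sum>n\<in>S. \<Sum>k\<in>S. M n k * x k)"
    using x assms by simp
  also have "\<dots> = (\<Sum>n\<in>S. mass n * neg_gen (X x) n * 1)
      + (\<Sum>n\<in>S. mass n) * (\<Sum>k\<in>S. mass k * x k)"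
    unfolding M sum_distrib_right by (simp add: sum.distrib)
  also have "(\<Sum>n\<in>S. mass n * neg_gen (X x) n * 1) = 0"
    unfolding sum_neg_gen dirichlet_def by (simp add: forward_diff_def)
  finally have "(\<Sum>k\<in>S. mass k * x k) = 0"
    using mass_total by simp
  then have "neg_gen (X x) n = f n" if "n \<in> S" for n
    using x[OF that] mass_pos[OF that] unfolding M by simp
  then show thesis
    by (rule that)
qed

section \<open>Commutation of gradient and generator, and Bochner's inequality\<close>

text \<open>Passing from \<open>n\<close> to \<open>n + axis i 1\<close> raises the death rate only
  for \<open>j = i\<close>, by one; the resulting extra difference of \<open>g\<close> becomes the
  diagonal summand of the curvature. The change of the birth rates yields the rest of the
  curvature.\<close>

lemma forward_diff_neg_gen:
  "forward_diff (neg_gen g) n i = (\<Sum>j\<in>UNIV.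
      real (n $ j) * forward_diff (\<lambda>k. forward_diff g k j) (n - axis j 1) i
      + (if i = j then forward_diff g n i else 0)
      - a (n + axis i 1 + axis j 1) / a (n + axis i 1)
          * (forward_diff (\<lambda>k. forward_diff g k j) n i + forward_diff g n j)
      + a (n + axis j 1) / a n * forward_diff g n j)"
proof -
  let ?D = "forward_diff g"
  \<comment> \<open>At \<open>n $ j = 0\<close> the truncated \<open>n - axis j 1\<close> is
    \<open>n\<close> itself, but its coefficient is zero.\<close>
  have "real ((n + axis i 1) $ j) * ?D (n + axis i 1 - axis j 1) j
      = real (n $ j) * ?D (n - axis j 1 + axis i 1) j + (if i = j then ?D n i else 0)" for j
  proof (cases "n $ j = 0")
    case True
    then show ?thesis
      by (cases "i = j") (auto simp: add_axis_diff_axis, simp_all add: axis_def)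
  next
    case False
    then have "(n + axis i 1) $ j = n $ j + (if i = j then 1 else 0)"
      "n + axis i 1 - axis j 1 = n - axis j 1 + axis i 1"
      "i = j \<Longrightarrow> n - axis j 1 + axis i 1 = n"
      by (simp_all add: add_axis_diff_axis_swap diff_axis_add_axis, simp add: axis_def)
    then show ?thesis
      by (cases "i = j") (simp_all add: distrib_right)
  qed
  then show ?thesis
    unfolding forward_diff_def[of "neg_gen g"] neg_gen_def sum_subtractf[symmetric]
    by (intro sum.cong refl) (simp add: forward_diff_def[of "\<lambda>k. ?D k _"] algebra_simps)
qed

text \<open>Bochner's inequality: the two sides differ by
  \<open>\<Sum>n\<in>S. \<Sum>i. \<Sum>j. a (n + axis i 1 + axis j 1) / vec_fact n * (\<nabla>\<^sub>i \<nabla>\<^sub>j g n)\<^sup>2\<close>.\<close>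

lemma bochner:
  defines "u \<equiv> \<lambda>g n i. a (n + axis i 1) / a n * forward_diff g n i"
  shows "(\<Sum>n\<in>S. mass n * quad_form_on UNIV (curvature a n) (u g n)) \<le> dirichlet g (neg_gen g)"
proof -
  let ?D = "forward_diff g"
  define W where "W i j n = forward_diff (\<lambda>k. ?D k j) n i" for i j n
  define A where "A i j n = a (n + axis i 1 + axis j 1)" for i j n
  have W_sym: "W i j n = ?D (n + axis j 1) i - ?D n i" for i j n
    unfolding W_def by (subst forward_diff_commute) (simp add: forward_diff_def)
  \<comment> \<open>Second-order terms: shifting the death part by \<open>axis j 1\<close> replaces
    \<open>?D n i\<close> by \<open>?D (n + axis j 1) i\<close>. The difference of these two is
    again \<open>W i j n\<close>, which leaves a weighted sum of squares.\<close>
  have rest: "0 \<le> (\<Sum>n\<in>S. real (n $ j) * (a (n + axis i 1) * ?D n i * W i j (n - axis j 1)) / vec_fact n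
      - A i j n * ?D n i * W i j n / vec_fact n)" for i j
  proof -
    have "(\<Sum>n\<in>S. real (n $ j) * (a (n + axis i 1) * ?D n i * W i j (n - axis j 1)) / vec_fact n)
        = (\<Sum>n\<in>S. A i j n * ?D (n + axis j 1) i * W i j n / vec_fact n)"
      using S_add_axisD
      by (subst sum_shift, metis a_zero mult_zero_left)
        (simp add: add_axis_diff_axis A_def ac_simps)
    then have "(\<Sum>n\<in>S. real (n $ j) * (a (n + axis i 1) * ?D n i * W i j (n - axis j 1)) / vec_fact n
        - A i j n * ?D n i * W i j n / vec_fact n)
        = (\<Sum>n\<in>S. A i j n * (W i j n * W i j n) / vec_fact n)"
      unfolding sum_subtractf
      by (simp only: flip: sum_subtractf)
        (simp add: W_sym[of i j] algebra_simps diff_divide_distrib add_divide_distrib)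
    also have "\<dots> \<ge> 0"
      by (intro sum_nonneg) (simp add: A_def a_nonneg vec_fact_pos less_imp_le)
    finally show ?thesis .
  qed
  \<comment> \<open>The first-order terms reproduce the curvature form at \<open>u\<close>. If
    \<open>n + axis i 1\<close> or \<open>n + axis j 1\<close> lies off \<open>S\<close>, both sides
    vanish.\<close>
  have curv: "a (n + axis i 1) / vec_fact n * ?D n i
      * ((if i = j then ?D n i else 0) - A i j n / a (n + axis i 1) * ?D n j
        + a (n + axis j 1) / a n * ?D n j)
      = mass n * (u g n i * curvature a n i j * u g n j)" if "n \<in> S" for n i j
  proof -
    have A0: "A i j n = 0" if "n + axis j 1 \<notin> S"
      using that S_add_axisD[of "n + axis j 1" i] a_zero by (auto simp: A_def ac_simps)
    show ?thesis
    proof (cases "n + axis i 1 \<in> S \<and> n + axis j 1 \<in> S")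
      case True
      have identity: "x / w * s * (r * (y / p * t) - z / x * t + y / p * t)
          = p / w * (x / p * s * (1 - p * z / (x * y) + r) * (y / p * t))"
        if "x \<noteq> 0" "y \<noteq> 0" "p \<noteq> 0" "w \<noteq> 0" for x y p w r s t z :: real
        using that by (simp add: field_simps)
      have nz: "a n \<noteq> 0" "a (n + axis i 1) \<noteq> 0" "a (n + axis j 1) \<noteq> 0" "vec_fact n \<noteq> 0"
        using True a_pos[OF that] a_pos[of "n + axis i 1"] a_pos[of "n + axis j 1"]
          vec_fact_pos[of n] by auto
      \<comment> \<open>The contribution of the death rates is rewritten through \<open>u\<close>,
        which produces the diagonal entry \<open>a n / a (n + axis i 1)\<close>.\<close>
      have diag: "(if i = j then ?D n i else 0)
          = (if i = j then a n / a (n + axis i 1) else 0) * (a (n + axis j 1) / a n * ?D n j)"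
        using nz by simp
      show ?thesis
        unfolding diag u_def mass_def curvature_def A_def by (rule identity[OF nz(2,3,1,4)])
    next
      case False
      then show ?thesis
        using A0 a_zero by (auto simp: u_def)
    qed
  qed
  have "dirichlet g (neg_gen g) = (\<Sum>n\<in>S. \<Sum>i\<in>UNIV. \<Sum>j\<in>UNIV.
      mass n * (u g n i * curvature a n i j * u g n j)
      + (real (n $ j) * (a (n + axis i 1) * ?D n i * W i j (n - axis j 1)) / vec_fact n
         - A i j n * ?D n i * W i j n / vec_fact n))"
    unfolding dirichlet_def forward_diff_neg_gen sum_distrib_left
  proof (intro sum.cong refl)
    fix n i j assume "n \<in> S"
    \<comment> \<open>Where \<open>a (n + axis i 1)\<close> is 0 the quotient is 0 by convention,
      and downward closure makes \<open>A i j n\<close> vanish as well.\<close>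
    have "a (n + axis i 1) * (A i j n / a (n + axis i 1)) = A i j n"
    proof (cases "n + axis i 1 \<in> S")
      case True
      then show ?thesis
        using a_pos[OF True] by simp
    next
      case False
      then have "A i j n = 0"
        unfolding A_def using S_add_axisD a_zero by blast
      then show ?thesis by simp
    qed
    moreover have "x / w * s * (q / x * t) = x * (q / x) * s * t / w" for x w s q t :: real
      by simp
    ultimately have A: "a (n + axis i 1) / vec_fact n * ?D n i * (A i j n / a (n + axis i 1) * W i j n)
        = A i j n * ?D n i * W i j n / vec_fact n"
      by presburger
    have identity: "x / w * s * (k * V + e - q * (V' + t) + y)
        = x / w * s * (e - q * t + y) + (k * (x * s * V) / w - x / w * s * (q * V'))"
      for x w s k V e q V' t y :: real
      by (simp add: algebra_simps add_divide_distrib diff_divide_distrib)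
    show "a (n + axis i 1) / vec_fact n * ?D n i *
        (real (n $ j) * forward_diff (\<lambda>k. ?D k j) (n - axis j 1) i + (if i = j then ?D n i else 0)
         - a (n + axis i 1 + axis j 1) / a (n + axis i 1)
             * (forward_diff (\<lambda>k. ?D k j) n i + ?D n j)
         + a (n + axis j 1) / a n * ?D n j)
        = mass n * (u g n i * curvature a n i j * u g n j)
        + (real (n $ j) * (a (n + axis i 1) * ?D n i * W i j (n - axis j 1)) / vec_fact n
           - A i j n * ?D n i * W i j n / vec_fact n)"
      unfolding curv[OF \<open>n \<in> S\<close>, symmetric] A[symmetric]
      unfolding W_def[symmetric] A_def[symmetric]
      by (rule identity)
  qed
  also have "\<dots> = (\<Sum>n\<in>S. mass n * quad_form_on UNIV (curvature a n) (u g n))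
      + (\<Sum>n\<in>S. \<Sum>i\<in>UNIV. \<Sum>j\<in>UNIV.
        real (n $ j) * (a (n + axis i 1) * ?D n i * W i j (n - axis j 1)) / vec_fact n
         - A i j n * ?D n i * W i j n / vec_fact n)"
    by (simp only: sum.distrib quad_form_on_def sum_distrib_left)
  also have "(\<Sum>n\<in>S. \<Sum>i\<in>UNIV. \<Sum>j\<in>UNIV.
        real (n $ j) * (a (n + axis i 1) * ?D n i * W i j (n - axis j 1)) / vec_fact n
         - A i j n * ?D n i * W i j n / vec_fact n)
      = (\<Sum>i\<in>UNIV. \<Sum>j\<in>UNIV. \<Sum>n\<in>S.
        real (n $ j) * (a (n + axis i 1) * ?D n i * W i j (n - axis j 1)) / vec_fact n
         - A i j n * ?D n i * W i j n / vec_fact n)" (is "_ = ?R")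
    by (subst sum.swap, intro sum.cong refl, rule sum.swap)
  finally have "dirichlet g (neg_gen g)
      = (\<Sum>n\<in>S. mass n * quad_form_on UNIV (curvature a n) (u g n)) + ?R" .
  moreover have "0 \<le> ?R"
    by (intro sum_nonneg rest)
  ultimately show ?thesis by linarith
qed

text \<open>For \<open>neg_gen g = f\<close> on \<open>S\<close>, summation by parts equates the
  second moment with the pairing of \<open>u\<close> and the gradient, and \<open>bochner\<close>
  bounds it below by the curvature form at \<open>u\<close>; subtract the latter from twice the
  former. The bound keeps \<open>u\<close>, so that curvatures can be compared before
  optimising.\<close>

lemma variance_le_dual:
  assumes "(\<Sum>n\<in>S. mass n * f n) = 0"
  obtains u where "\<And>n i. n + axis i 1 \<notin> S \<Longrightarrow> u n i = 0"
    and "(\<Sum>n\<in>S. mass n * (f n)\<^sup>2) \<le> (\<Sum>n\<in>S. mass n *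
      (2 * (\<Sum>i\<in>UNIV. u n i * forward_diff f n i) - quad_form_on UNIV (curvature a n) (u n)))"
proof -
  obtain g where g: "\<And>n. n \<in> S \<Longrightarrow> neg_gen g n = f n"
    using neg_gen_solvable[OF assms] by blast
  define u where "u n i = a (n + axis i 1) / a n * forward_diff g n i" for n i
  have f: "(\<Sum>n\<in>S. mass n * (f n)\<^sup>2) = dirichlet g f"
    unfolding sum_neg_gen[symmetric] by (simp add: g power2_eq_square mult.assoc)
  also have "\<dots> = (\<Sum>n\<in>S. mass n * (\<Sum>i\<in>UNIV. u n i * forward_diff f n i))"
    unfolding dirichlet_def sum_distrib_left
  proof (intro sum.cong refl)
    fix n i assume "n \<in> S"
    then show "a (n + axis i 1) / vec_fact n * forward_diff g n i * forward_diff f n i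
        = mass n * (u n i * forward_diff f n i)"
      using a_pos[of n] by (simp add: u_def mass_def)
  qed
  finally have grad: "(\<Sum>n\<in>S. mass n * (f n)\<^sup>2)
      = (\<Sum>n\<in>S. mass n * (\<Sum>i\<in>UNIV. u n i * forward_diff f n i))" .
  have "(\<Sum>n\<in>S. mass n * quad_form_on UNIV (curvature a n) (u n)) \<le> dirichlet g (neg_gen g)"
    unfolding u_def by (rule bochner)
  also have "\<dots> = (\<Sum>n\<in>S. mass n * (f n)\<^sup>2)"
    unfolding sum_neg_gen[symmetric] by (simp add: g power2_eq_square mult.assoc)
  finally have "(\<Sum>n\<in>S. mass n * quad_form_on UNIV (curvature a n) (u n))
      \<le> (\<Sum>n\<in>S. mass n * (f n)\<^sup>2)" .
  with grad have "(\<Sum>n\<in>S. mass n * (f n)\<^sup>2) \<le> (\<Sum>n\<in>S. mass n *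
      (2 * (\<Sum>i\<in>UNIV. u n i * forward_diff f n i) - quad_form_on UNIV (curvature a n) (u n)))"
    by (simp add: right_diff_distrib sum_subtractf mult.left_commute[of _ 2] flip: sum_distrib_left)
  then show thesis
    by (intro that[of u]) (auto simp: u_def a_zero)
qed

end

section \<open>Truncation to boxes\<close>

lemma quad_form_on_UNIV:
  assumes "\<And>i. i \<notin> I \<Longrightarrow> x i = 0"
  shows "quad_form_on UNIV K x = quad_form_on I K (x :: 'd::finite \<Rightarrow> real)"
  using assms unfolding quad_form_on_def
  by (intro sum.mono_neutral_cong_right ballI sum.neutral) (auto intro!: sum.mono_neutral_right)

lemma finite_box: "finite {n :: nat ^ 'd::finite. \<forall>i. n $ i \<le> N}"
proof (rule finite_surj)
  show "finite (UNIV \<rightarrow>\<^sub>E {..N} :: ('d \<Rightarrow> nat) set)"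
    by (intro finite_PiE) auto
  show "{n :: nat ^ 'd. \<forall>i. n $ i \<le> N} \<subseteq> vec_lambda ` (UNIV \<rightarrow>\<^sub>E {..N})"
  proof
    fix n :: "nat ^ 'd"
    assume "n \<in> {n. \<forall>i. n $ i \<le> N}"
    then show "n \<in> vec_lambda ` (UNIV \<rightarrow>\<^sub>E {..N})"
      by (intro image_eqI[of _ _ "vec_nth n"]) (auto simp: PiE_def)
  qed
qed

text \<open>Restricting the measure to a box changes only the diagonal of the curvature matrices
  (apart from deleting rows and columns), and it can only increase it.\<close>

lemma variance_box_le:
  fixes \<mu> :: "(nat ^ 'd::finite) pmf" and f :: "nat ^ 'd \<Rightarrow> real" and N :: nat
  assumes dc: "downward_closed (set_pmf \<mu>)"
    and pd: "\<And>n. n \<in> set_pmf \<mu> \<Longrightarrow> pos_def_on (active \<mu> n) (curvature_matrix \<mu> n)"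
  defines "S \<equiv> set_pmf \<mu> \<inter> {n. \<forall>i. n $ i \<le> N}"
  shows "(\<Sum>n\<in>S. pmf \<mu> n * (f n)\<^sup>2) - (\<Sum>n\<in>S. pmf \<mu> n * f n)\<^sup>2 / (\<Sum>n\<in>S. pmf \<mu> n)
    \<le> (\<Sum>n\<in>S. pmf \<mu> n *
      quad_form_on (active \<mu> n) (inverse_on (active \<mu> n) (curvature_matrix \<mu> n)) (forward_diff f n))"
proof -
  define a where "a n = (if n \<in> S then weight \<mu> n else 0)" for n
  have weight_pos: "0 < weight \<mu> n" if "n \<in> set_pmf \<mu>" for n
    using that by (simp add: weight_def vec_fact_pos pmf_positive)
  have weight_nonneg: "0 \<le> weight \<mu> n" for n
    by (simp add: weight_def vec_fact_pos less_imp_le)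
  interpret finite_weight a S
  proof
    show "finite S"
      by (auto simp: S_def intro: finite_subset[OF _ finite_box])
    show "downward_closed S"
      using dc unfolding downward_closed_def S_def less_eq_vec_def
      by (fastforce intro: order_trans)
    obtain n where "n \<in> set_pmf \<mu>"
      using set_pmf_not_empty by fast
    then have "0 \<in> set_pmf \<mu>"
      using dc by (auto simp: downward_closed_def less_eq_vec_def)
    then show "0 \<in> S"
      by (simp add: S_def)
  qed (auto simp: a_def S_def weight_pos)
  have mass: "mass n = pmf \<mu> n" if "n \<in> S" for n
    using that vec_fact_pos[of n] by (simp add: mass_def a_def weight_def)
  define Z where "Z = (\<Sum>n\<in>S. pmf \<mu> n)"
  \<comment> \<open>The box need not carry full mass, so \<open>f\<close> is centred by its
    conditional mean.\<close>
  define c where "c = (\<Sum>n\<in>S. pmf \<mu> n * f n) / Z"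
  have "0 < Z"
    unfolding Z_def using finite_S zero_in_S
    by (intro sum_pos) (auto simp: S_def pmf_positive)
  then have cZ: "(\<Sum>n\<in>S. pmf \<mu> n * f n) = c * Z"
    by (simp add: c_def)
  have "(\<Sum>n\<in>S. mass n * (f n - c)) = 0"
    using cZ by (simp add: mass right_diff_distrib sum_subtractf Z_def mult.commute[of _ c]
        flip: sum_distrib_left)
  then obtain u where u0: "\<And>n i. n + axis i 1 \<notin> S \<Longrightarrow> u n i = 0"
    and u: "(\<Sum>n\<in>S. mass n * (f n - c)\<^sup>2) \<le> (\<Sum>n\<in>S. mass n *
      (2 * (\<Sum>i\<in>UNIV. u n i * forward_diff (\<lambda>n. f n - c) n i)
        - quad_form_on UNIV (curvature a n) (u n)))"
    by (rule variance_le_dual) blast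
  have "(\<Sum>n\<in>S. pmf \<mu> n * (f n)\<^sup>2) - (c * Z)\<^sup>2 / Z = (\<Sum>n\<in>S. pmf \<mu> n * (f n - c)\<^sup>2)"
  proof -
    have "(\<Sum>n\<in>S. pmf \<mu> n * (f n - c)\<^sup>2)
        = (\<Sum>n\<in>S. pmf \<mu> n * (f n)\<^sup>2 - 2 * c * (pmf \<mu> n * f n) + c\<^sup>2 * pmf \<mu> n)"
      by (intro sum.cong) (auto simp: power2_eq_square algebra_simps)
    also have "\<dots> = (\<Sum>n\<in>S. pmf \<mu> n * (f n)\<^sup>2) - 2 * c * (c * Z) + c\<^sup>2 * Z"
      by (simp add: sum.distrib sum_subtractf cZ Z_def flip: sum_distrib_left)
    finally show ?thesis
      using \<open>0 < Z\<close> by (simp add: power2_eq_square)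
  qed
  also have "\<dots> = (\<Sum>n\<in>S. mass n * (f n - c)\<^sup>2)"
    by (simp add: mass)
  also note u
  also have "(\<Sum>n\<in>S. mass n * (2 * (\<Sum>i\<in>UNIV. u n i * forward_diff (\<lambda>n. f n - c) n i)
        - quad_form_on UNIV (curvature a n) (u n)))
      \<le> (\<Sum>n\<in>S. pmf \<mu> n *
      quad_form_on (active \<mu> n) (inverse_on (active \<mu> n) (curvature_matrix \<mu> n)) (forward_diff f n))"
  proof (rule sum_mono)
    fix n assume n: "n \<in> S"
    let ?I = "active \<mu> n" and ?K = "curvature_matrix \<mu> n"
    have I: "u n i = 0" if "i \<notin> ?I" for i
      using that by (intro u0) (auto simp: active_def S_def)
    \<comment> \<open>On indices where \<open>u n\<close> can be nonzero the matrices differ only on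
      the diagonal, where \<open>u n i\<close> enters squared, so a termwise comparison
      suffices.\<close>
    have "quad_form_on UNIV ?K (u n) \<le> quad_form_on UNIV (curvature a n) (u n)"
      unfolding quad_form_on_def
    proof (intro sum_mono)
      fix i j
      show "u n i * ?K i j * u n j \<le> u n i * curvature a n i j * u n j"
      proof (cases "n + axis i 1 \<in> S \<and> n + axis j 1 \<in> S")
        case True
        then have a: "a n = weight \<mu> n" "a (n + axis i 1) = weight \<mu> (n + axis i 1)"
          "a (n + axis j 1) = weight \<mu> (n + axis j 1)"
          using n by (auto simp: a_def)
        show ?thesis
        proof (cases "i = j")
          case False
          have "a (n + axis i 1 + axis j 1) = weight \<mu> (n + axis i 1 + axis j 1)"
          proof (cases "n + axis i 1 + axis j 1 \<in> set_pmf \<mu>")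
            case True
            \<comment> \<open>As \<open>i\<close> and \<open>j\<close> differ, no coordinate is
              raised twice, so one of the two single steps already gives the bound.\<close>
            have "(n + axis i 1 + axis j 1) $ k \<le> N" for k
            proof -
              have "(n + axis i 1) $ k \<le> N" "(n + axis j 1) $ k \<le> N"
                using \<open>n + axis i 1 \<in> S \<and> n + axis j 1 \<in> S\<close> unfolding S_def by blast+
              then show ?thesis
                using False by (cases "k = i") (simp_all add: axis_def)
            qed
            then have "n + axis i 1 + axis j 1 \<in> S"
              using True unfolding S_def by blast
            then show ?thesis by (simp add: a_def)
          qed (simp add: a_def weight_def set_pmf_iff)
          then show ?thesis
            by (simp add: curvature_matrix_eq curvature_def a)
        next
          case True
          \<comment> \<open>A double step in direction \<open>i\<close> may leave the box; the
            truncated weight is then 0 and the subtracted quotient drops out, which raises the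
            diagonal entry.\<close>
          have "a (n + axis i 1 + axis j 1) \<le> weight \<mu> (n + axis i 1 + axis j 1)"
            by (simp add: a_def weight_nonneg)
          then have "?K i j \<le> curvature a n i j"
            unfolding curvature_matrix_eq curvature_def a
            by (intro add_right_mono diff_left_mono divide_right_mono mult_left_mono)
              (simp_all add: weight_nonneg)
          then have "(u n i)\<^sup>2 * ?K i j \<le> (u n i)\<^sup>2 * curvature a n i j"
            by (rule mult_left_mono) simp
          then show ?thesis
            using True by (simp add: power2_eq_square ac_simps)
        qed
      qed (auto simp: u0)
    qed
    then have "2 * (\<Sum>i\<in>UNIV. u n i * forward_diff (\<lambda>n. f n - c) n i)
        - quad_form_on UNIV (curvature a n) (u n)
        \<le> 2 * (\<Sum>i\<in>?I. u n i * forward_diff f n i) - quad_form_on ?I ?K (u n)"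
      using I sum.mono_neutral_right[of UNIV ?I "\<lambda>i. u n i * forward_diff f n i"]
      by (simp add: forward_diff_def quad_form_on_UNIV[of ?I "u n"])
    also have "\<dots> \<le> quad_form_on ?I (inverse_on ?I ?K) (forward_diff f n)"
      using n by (intro quad_form_on_inverse_ge pd) (auto simp: S_def)
    finally show "mass n * (2 * (\<Sum>i\<in>UNIV. u n i * forward_diff (\<lambda>n. f n - c) n i)
        - quad_form_on UNIV (curvature a n) (u n))
        \<le> pmf \<mu> n * quad_form_on ?I (inverse_on ?I ?K) (forward_diff f n)"
      using n by (simp add: mass mult_left_mono)
  qed
  finally show ?thesis
    by (simp add: cZ Z_def)
qed

section \<open>Passage from boxes to the full measure\<close>

text \<open>Membership in \<open>A\<close> is asked only on the support, since \<open>f\<close> and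
  its gradient form may take any values elsewhere; \<open>h\<close> is almost everywhere equal to a
  finite sum of indicators.\<close>

lemma expectation_finite_support:
  fixes h :: "'a \<Rightarrow> real"
  assumes "finite A" "\<And>n. n \<in> set_pmf p \<Longrightarrow> h n \<noteq> 0 \<Longrightarrow> n \<in> A"
  shows "integrable (measure_pmf p) h" "measure_pmf.expectation p h = (\<Sum>n\<in>A. pmf p n * h n)"
proof -
  let ?h = "\<lambda>n. if n \<in> A then h n else 0"
  have ae: "AE n in measure_pmf p. ?h n = h n"
    using assms(2) by (auto simp: AE_measure_pmf_iff)
  have "integrable (measure_pmf p) (\<lambda>n. \<Sum>k\<in>A. h k * indicator {k} n)"
    by (intro Bochner_Integration.integrable_sum integrable_mult_right integrable_real_indicator)
      (auto simp: measure_pmf.emeasure_finite less_top[symmetric])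
  also have "(\<lambda>n. \<Sum>k\<in>A. h k * indicator {k} n) = ?h"
    using assms(1) by (auto simp: fun_eq_iff indicator_def if_distrib cong: if_cong)
  finally have "integrable (measure_pmf p) ?h" .
  then show "integrable (measure_pmf p) h"
    using ae by (subst integrable_cong_AE[symmetric]) auto
  have "measure_pmf.expectation p h = measure_pmf.expectation p ?h"
    using ae by (intro integral_cong_AE) auto
  also have "\<dots> = (\<Sum>n\<in>A. pmf p n * h n)"
    using assms(1) by (subst integral_measure_pmf[of A]) (auto split: if_splits)
  finally show "measure_pmf.expectation p h = (\<Sum>n\<in>A. pmf p n * h n)" .
qed

theorem theorem3p12:
  fixes \<mu> :: "(nat ^ 'd::finite) pmf" and f :: "nat ^ 'd \<Rightarrow> real"
  assumes "downward_closed (set_pmf \<mu>)"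
    and "\<And>n. n \<in> set_pmf \<mu> \<Longrightarrow> pos_def_on (active \<mu> n) (curvature_matrix \<mu> n)"
    and "finite {n \<in> set_pmf \<mu>. f n \<noteq> 0}"
  shows "measure_pmf.variance \<mu> f \<le>
    measure_pmf.expectation \<mu> (\<lambda>n.
      quad_form_on (active \<mu> n) (inverse_on (active \<mu> n) (curvature_matrix \<mu> n))
        (forward_diff f n))"
proof -
  define F where "F n = quad_form_on (active \<mu> n)
    (inverse_on (active \<mu> n) (curvature_matrix \<mu> n)) (forward_diff f n)" for n
  define A where "A = {n \<in> set_pmf \<mu>. f n \<noteq> 0}"
  \<comment> \<open>The gradient at \<open>n\<close> sees only \<open>n\<close> and its upper
    neighbours, so on the support of the measure \<open>F\<close> can be nonzero only in
    \<open>A\<close> and its backward shifts.\<close>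
  define B where "B = A \<union> (\<Union>i. (\<lambda>n. n - axis i 1) ` A)"
  define S where "S N = set_pmf \<mu> \<inter> {n. \<forall>i. n $ i \<le> N}" for N
  have fin: "finite A" "finite B"
    using assms(3) by (auto simp: A_def B_def)
  have finS: "finite (S N)" for N
    by (auto simp: S_def intro: finite_subset[OF _ finite_box])
  \<comment> \<open>The variational bound at the test vector 0.\<close>
  have F_nonneg: "0 \<le> F n" if "n \<in> set_pmf \<mu>" for n
    using quad_form_on_inverse_ge[OF _ assms(2)[OF that], of "\<lambda>_. 0"]
    by (simp add: F_def quad_form_on_def)
  have F_supp: "n \<in> B" if n: "n \<in> set_pmf \<mu>" "F n \<noteq> 0" for n
  proof -
    obtain i where i: "i \<in> active \<mu> n" "forward_diff f n i \<noteq> 0"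
      using n(2) unfolding F_def quad_form_on_def
      by (metis (no_types, lifting) mult_eq_0_iff sum.neutral)
    show ?thesis
    proof (cases "n \<in> A")
      case False
      then have "n + axis i 1 \<in> A"
        using i n(1) by (auto simp: A_def active_def forward_diff_def)
      then show ?thesis
        unfolding B_def using add_axis_diff_axis[of n i] by (metis UNIV_I UnI2 UN_I image_eqI)
    qed (simp add: B_def)
  qed
  have EF: "measure_pmf.expectation \<mu> F = (\<Sum>n\<in>B. pmf \<mu> n * F n)"
    using fin F_supp by (intro expectation_finite_support)
  \<comment> \<open>Nonnegativity of \<open>F\<close> on the support replaces the box sum by a bound
    independent of \<open>N\<close>.\<close>
  have S_le: "(\<Sum>n\<in>S N. pmf \<mu> n * F n) \<le> measure_pmf.expectation \<mu> F" for N
  proof -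
    have "(\<Sum>n\<in>S N. pmf \<mu> n * F n) = (\<Sum>n\<in>S N \<inter> B. pmf \<mu> n * F n)"
      using finS F_supp by (intro sum.mono_neutral_right) (auto simp: S_def)
    also have "\<dots> \<le> (\<Sum>n\<in>B. pmf \<mu> n * F n)"
    proof (intro sum_mono2)
      show "0 \<le> pmf \<mu> n * F n" for n
        using F_nonneg[of n] by (cases "n \<in> set_pmf \<mu>") (auto simp: set_pmf_iff)
    qed (use fin in auto)
    finally show ?thesis by (simp add: EF)
  qed
  have Ef: "integrable \<mu> f" "measure_pmf.expectation \<mu> f = (\<Sum>n\<in>A. pmf \<mu> n * f n)"
    and Ef2: "integrable \<mu> (\<lambda>n. (f n)\<^sup>2)"
      "measure_pmf.expectation \<mu> (\<lambda>n. (f n)\<^sup>2) = (\<Sum>n\<in>A. pmf \<mu> n * (f n)\<^sup>2)"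
    using fin by (auto intro!: expectation_finite_support simp: A_def)
  obtain M where M: "\<And>n i. n \<in> A \<Longrightarrow> n $ i \<le> M"
  proof -
    have "finite (\<Union>i. (\<lambda>n. n $ i) ` A)"
      using fin by auto
    then show thesis
      by (intro that[of "Max (\<Union>i. (\<lambda>n. n $ i) ` A)"] Max_ge) auto
  qed
  define Z where "Z N = measure_pmf.prob \<mu> {n. \<forall>i. n $ i \<le> N}" for N
  \<comment> \<open>Once the box contains \<open>A\<close>, it captures both moments of
    \<open>f\<close> entirely, and only \<open>Z N\<close> still depends on
    \<open>N\<close>.\<close>
  have bound: "measure_pmf.expectation \<mu> (\<lambda>n. (f n)\<^sup>2) - (measure_pmf.expectation \<mu> f)\<^sup>2 / Z N
      \<le> measure_pmf.expectation \<mu> F" if "M \<le> N" for N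
  proof -
    have sub: "A \<subseteq> S N"
      using M that by (auto simp: A_def S_def intro: order_trans)
    have "Z N = measure_pmf.prob \<mu> (S N)"
      unfolding Z_def S_def by (metis Int_commute measure_Int_set_pmf)
    then have "Z N = (\<Sum>n\<in>S N. pmf \<mu> n)"
      using finS by (simp add: measure_measure_pmf_finite)
    moreover have "(\<Sum>n\<in>A. pmf \<mu> n * f n) = (\<Sum>n\<in>S N. pmf \<mu> n * f n)"
      "(\<Sum>n\<in>A. pmf \<mu> n * (f n)\<^sup>2) = (\<Sum>n\<in>S N. pmf \<mu> n * (f n)\<^sup>2)"
      using sub finS by (auto intro!: sum.mono_neutral_left simp: A_def S_def)
    ultimately show ?thesis
      using variance_box_le[OF assms(1,2), where N = N and f = f] S_le[of N]
      unfolding Ef Ef2 F_def[symmetric] S_def[symmetric] by simp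
  qed
  \<comment> \<open>The boxes exhaust the space, so the normalising mass tends to 1 and the left
    side of \<open>bound\<close> tends to the variance.\<close>
  have "Z \<longlonglongrightarrow> measure_pmf.prob \<mu> (\<Union>N. {n. \<forall>i. n $ i \<le> N})"
    unfolding Z_def
    by (rule measure_pmf.finite_Lim_measure_incseq) (auto simp: incseq_def intro: order_trans)
  also have "(\<Union>N. {n. \<forall>i. n $ i \<le> N}) = (UNIV :: (nat ^ 'd) set)"
  proof -
    have "n $ i \<le> (\<Sum>i\<in>UNIV. n $ i)" for n :: "nat ^ 'd" and i
      by (rule member_le_sum) auto
    then show ?thesis by blast
  qed
  finally have "Z \<longlonglongrightarrow> 1" by simp
  then have "(\<lambda>N. measure_pmf.expectation \<mu> (\<lambda>n. (f n)\<^sup>2) - (measure_pmf.expectation \<mu> f)\<^sup>2 / Z N)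
      \<longlonglongrightarrow> measure_pmf.expectation \<mu> (\<lambda>n. (f n)\<^sup>2) - (measure_pmf.expectation \<mu> f)\<^sup>2 / 1"
    by (intro tendsto_intros) auto
  then have "measure_pmf.expectation \<mu> (\<lambda>n. (f n)\<^sup>2) - (measure_pmf.expectation \<mu> f)\<^sup>2 / 1
      \<le> measure_pmf.expectation \<mu> F"
    by (rule LIMSEQ_le_const2) (use bound in blast)
  then show ?thesis
    unfolding F_def using measure_pmf.variance_eq[OF Ef(1) Ef2(1)] by simp
qed

end
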